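(* Let $\frac12\le p<1$ and let $\varepsilon$ be a real number with $\varepsilon\le 1$ and $\frac{1-p}{p}\le\varepsilon<\frac{2(1-p)}{p}$. Then the functions $f$ and $g$ given on the open unit disk $\mathbb{D}$ by $$f(z)=\frac{(1+z)^{2-\varepsilon}}{(1-z)^{2+\varepsilon}},\qquad g(z)=-f(-z)=-\frac{(1-z)^{2-\varepsilon}}{(1+z)^{2+\varepsilon}}$$ fail to satisfy the triangle inequality for $\|\cdot\|_{A^p}$; that is, $\|f+g\|_{A^p}>\|f\|_{A^p}+\|g\|_{A^p}$.
   Context: $\mathbb{D}=\{z\in\mathbb{C}:|z|<1\}$, and $dA(z)=\frac{dx\,dy}{\pi}$ ($z=x+iy$) is the normalized Lebesgue area measure on $\mathbb{D}$. For $0<p<\infty$ and $f$ analytic in $\mathbb{D}$, $\|f\|_{A^p}=\left(\int_{\mathbb{D}}|f(z)|^p\,dA(z)\right)^{1/p}$; the Bergman space $A^p$ is the set of all $f$ analytic in $\mathbb{D}$ with $\|f\|_{A^p}<\infty$. The notation $\|\cdot\|_{A^p}$ is used also for $0<p<1$, although it need not be a norm. Powers $(1\pm z)^{s}$ with real exponent $s$ are defined by $\exp(s\log(1\pm z))$ with the branch of the logarithm satisfying $\log 1=0$ (the principal branch). *)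

theory Defs
  imports "HOL-Analysis.Analysis"
begin

definition disk_area :: "complex measure" where
  "disk_area = scale_measure (ennreal (1 / pi)) (restrict_space lborel (ball 0 1))"

text \<open>The functional takes values in \<^typ>\<open>ennreal\<close>, so that a function outside \<open>A\<^sup>p\<close>
  has norm \<^term>\<open>\<infinity> :: ennreal\<close>. It is meant for \<open>p > 0\<close>. Only the values of \<open>f\<close> on
  the unit disk matter. There is no \<open>powr\<close> on \<^typ>\<open>ennreal\<close>, hence the case distinction.\<close>

definition bergman_norm :: "real \<Rightarrow> (complex \<Rightarrow> complex) \<Rightarrow> ennreal" where
  "bergman_norm p f =
     (let I = (\<integral>\<^sup>+ z. ennreal (cmod (f z) powr p) \<partial>disk_area)
      in if I = \<infinity> then \<infinity> else ennreal (enn2real I powr (1 / p)))"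

end

theory Submission imports Defs begin

text \<open>Reflecting the disc by \<open>z \<mapsto> -z\<close> preserves area, so \<open>f\<close> and \<open>g\<close> have
the same norm, and the claim amounts to
\<open>2 powr p * \<integral> \<bar>f\<bar>^p < \<integral> \<bar>f + g\<bar>^p\<close>.
The two integrands are hard to compare at the same point: near 0 the sum is small while \<open>f\<close>
is not. They become comparable after a substitution. Since
\<open>(1 + z)^4 - (1 - z)^4 = 8 z (1 + z^2)\<close>, the sum is
\<open>f z + g z = 8 z (1 + z^2) / (1 - z^2) powr (2 + \<epsilon>)\<close>,
essentially a function of \<open>w = z^2\<close>, with the singularity at \<open>w = 1\<close> that
\<open>f(w)\<close> has (\<open>add_reflect_closed_form\<close>).

Squaring maps the disc onto itself two-to-one with Jacobian \<open>4 \<bar>z\<bar>^2\<close>, hence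
\<open>2 \<integral> \<bar>f(w)\<bar>^p dA(w) = \<integral> 4 \<bar>z\<bar>^2 \<bar>f(z^2)\<bar>^p dA(z)\<close>
(\<open>nn_integral_unit_disc_square\<close>). After this substitution the desired inequality holds
pointwise: the factors \<open>\<bar>1 - z^2\<bar>\<close> cancel, and what remains is
\<open>2 powr p * 4 * r^2 * s powr (p * (2 - \<epsilon>)) < 2 * (8 * r * s) powr p\<close>
for \<open>r = \<bar>z\<bar>\<close> and \<open>s = \<bar>1 + z^2\<bar>\<close> (\<open>pointwise_weight_bound\<close>). Here
\<open>s \<le> 2\<close>, and the lower bound on \<open>\<epsilon>\<close> makes the constants match. The
upper bound on \<open>\<epsilon>\<close> makes \<open>f\<close> belong to the Bergman space, so that the
strict inequality persists after integration.

The substitution rule for a holomorphic map is obtained from the change of variables theorem in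
\<open>real^2\<close>.\<close>

section \<open>Holomorphic substitution in area integrals\<close>

text \<open>The change of variables theorem speaks of absolute integrability together with the value of an
integral. This formula packs both into a single nonnegative integral, with \<open>\<infinity>\<close> for
non-integrability, so that the substitution rules below become plain equations between
elements of \<open>[0, \<infinity>]\<close>.\<close>

lemma set_nn_integral_lborel_cases:
  fixes k :: "'a::euclidean_space \<Rightarrow> real"
  assumes [measurable]: "k \<in> borel_measurable borel" "S \<in> sets borel"
    and nonneg: "\<And>x. 0 \<le> k x"
  shows "(\<integral>\<^sup>+x\<in>S. ennreal (k x) \<partial>lborel) =
    (if k absolutely_integrable_on S then ennreal (integral S k) else \<infinity>)"
proof (cases "k absolutely_integrable_on S")
  case True
  then have "(k has_integral integral S k) S"
    using set_lebesgue_integral_eq_integral(1) by blast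
  then show ?thesis
    using True nn_integral_has_integral_lebesgue'[of S k] nonneg by simp
next
  case False
  have "set_integrable lborel S k" if "(\<integral>\<^sup>+x\<in>S. ennreal (k x) \<partial>lborel) \<noteq> \<infinity>"
  proof -
    have "(\<integral>\<^sup>+x. ennreal (norm (indicator S x *\<^sub>R k x)) \<partial>lborel) = (\<integral>\<^sup>+x\<in>S. ennreal (k x) \<partial>lborel)"
      using nonneg by (intro nn_integral_cong) (auto simp: indicator_def)
    then show ?thesis
      using that unfolding set_integrable_def integrable_iff_bounded
      by (auto simp: top.not_eq_extremum)
  qed
  moreover have "\<not> set_integrable lborel S k"
    using False by (simp add: set_integrable_def integrable_completion)
  ultimately show ?thesis
    using False by auto
qed

lemma nn_integral_change_of_variables:
  fixes g :: "real^'m::{finite,wellorder} \<Rightarrow> real^'m::_" and h :: "real^'m::_ \<Rightarrow> real"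
  assumes S: "S \<in> sets borel" and gS: "g ` S \<in> sets borel"
    and der: "\<And>x. x \<in> S \<Longrightarrow> (g has_derivative g' x) (at x within S)"
    and inj: "inj_on g S"
    and h: "h \<in> borel_measurable borel" "\<And>x. 0 \<le> h x"
    and meas: "(\<lambda>x. \<bar>det (matrix (g' x))\<bar> * h (g x)) \<in> borel_measurable borel"
  shows "(\<integral>\<^sup>+x\<in>S. ennreal (\<bar>det (matrix (g' x))\<bar> * h (g x)) \<partial>lborel) =
    (\<integral>\<^sup>+y\<in>g ` S. ennreal (h y) \<partial>lborel)"
proof -
  let ?k = "\<lambda>x. \<bar>det (matrix (g' x))\<bar> * h (g x)"
  have S': "S \<in> sets lebesgue" using S by simp
  have eq: "?k absolutely_integrable_on S \<and> integral S ?k = b \<longleftrightarrow>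
        h absolutely_integrable_on g ` S \<and> integral (g ` S) h = b" for b
    using has_absolute_integral_change_of_variables[OF S' der inj, where f = "\<lambda>x. vec (h x) :: real^1" and b = "vec b"]
    by (auto simp: absolutely_integrable_on_1_iff integral_on_1_eq vec_eq_iff)
  have "(if ?k absolutely_integrable_on S then ennreal (integral S ?k) else \<infinity>) =
      (if h absolutely_integrable_on g ` S then ennreal (integral (g ` S) h) else \<infinity>)"
    using eq[of "integral S ?k"] eq[of "integral (g ` S) h"] by (auto split: if_splits)
  moreover have "0 \<le> ?k x" for x
    using h by simp
  ultimately show ?thesis
    using h by (subst (1 2) set_nn_integral_lborel_cases) (use S gS meas in auto)
qed

text \<open>The change of variables theorem lives on \<open>real^'n\<close>. Area integrals over the complex
plane are moved to \<open>real^2\<close> along this coordinate map.\<close>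

lemma lborel_distr_Complex:
  "distr lborel borel (\<lambda>x::real^2. Complex (x $ 1) (x $ 2)) = lborel"
proof (rule lborel_eqI[symmetric])
  have [measurable]: "(\<lambda>x::real^2. Complex (x $ 1) (x $ 2)) \<in> borel_measurable borel"
    by (intro borel_measurable_continuous_onI) (auto simp: Complex_eq intro!: continuous_intros)
  fix l u :: complex assume le: "\<And>b. b \<in> Basis \<Longrightarrow> l \<bullet> b \<le> u \<bullet> b"
  let ?v = "\<lambda>z::complex. vector [Re z, Im z] :: real^2"
  have "(\<lambda>x::real^2. Complex (x $ 1) (x $ 2)) -` box l u = box (?v l) (?v u)"
    by (auto simp: box_complex_eq mem_box_cart forall_2)
  moreover have le': "Re l \<le> Re u" "Im l \<le> Im u"
    using le[of 1] le[of \<i>] by (auto simp: Basis_complex_def)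
  moreover have B: "(Basis :: (real^2) set) = {axis 1 1, axis 2 1}"
    by (auto simp: Basis_vec_def UNIV_2)
  moreover have ne: "axis 1 1 \<noteq> (axis 2 1 :: real^2)"
    by (simp add: axis_eq_axis)
  moreover have "emeasure lborel (box (?v l) (?v u)) = ennreal ((Re u - Re l) * (Im u - Im l))"
    using le' ne by (simp add: emeasure_lborel_box_eq B inner_axis inner_diff_left)
  ultimately show "emeasure (distr lborel borel (\<lambda>x::real^2. Complex (x $ 1) (x $ 2))) (box l u) =
      (\<Prod>b\<in>Basis. (u - l) \<bullet> b)"
    by (simp add: emeasure_distr Basis_complex_def)
qed simp

text \<open>Multiplication by a complex number \<open>c\<close> is a rotation followed by a dilation of the plane,
hence has real determinant \<open>\<bar>c\<bar>\<^sup>2\<close>; this is the Jacobian of a map with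
complex derivative \<open>c\<close>.\<close>

lemma nn_integral_holomorphic_substitution:
  fixes g g' :: "complex \<Rightarrow> complex" and h :: "complex \<Rightarrow> real"
  assumes S[measurable]: "S \<in> sets borel" and gS[measurable]: "g ` S \<in> sets borel"
    and der: "\<And>z. z \<in> S \<Longrightarrow> (g has_field_derivative g' z) (at z within S)"
    and inj: "inj_on g S"
    and [measurable]: "g \<in> borel_measurable borel" "g' \<in> borel_measurable borel"
      "h \<in> borel_measurable borel"
    and h: "\<And>z. 0 \<le> h z"
  shows "(\<integral>\<^sup>+z\<in>S. ennreal ((cmod (g' z))\<^sup>2 * h (g z)) \<partial>lborel) =
    (\<integral>\<^sup>+w\<in>g ` S. ennreal (h w) \<partial>lborel)"
proof -
  define C :: "real^2 \<Rightarrow> complex" where "C x = Complex (x $ 1) (x $ 2)" for x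
  define V :: "complex \<Rightarrow> real^2" where "V z = vector [Re z, Im z]" for z
  have CV [simp]: "C (V z) = z" and VC [simp]: "V (C x) = x" for z x
    by (simp_all add: C_def V_def vec_eq_iff forall_2)
  have blC: "bounded_linear C"
    by (rule linear_conv_bounded_linear[THEN iffD1], rule linearI) (auto simp: C_def complex_eq_iff)
  have blV: "bounded_linear V"
    by (rule linear_conv_bounded_linear[THEN iffD1], rule linearI)
       (auto simp: V_def vec_eq_iff forall_2)
  have [measurable]: "C \<in> borel_measurable borel" "V \<in> borel_measurable borel"
    using blC blV by (auto intro!: borel_measurable_continuous_onI linear_continuous_on)
  have transfer: "(\<integral>\<^sup>+z\<in>A. ennreal (k z) \<partial>lborel) = (\<integral>\<^sup>+x\<in>V ` A. ennreal (k (C x)) \<partial>lborel)"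
    if [measurable]: "A \<in> sets borel" "k \<in> borel_measurable borel" for A and k :: "complex \<Rightarrow> real"
  proof -
    have "(\<integral>\<^sup>+z\<in>A. ennreal (k z) \<partial>lborel) = (\<integral>\<^sup>+z\<in>A. ennreal (k z) \<partial>distr lborel borel C)"
      using lborel_distr_Complex unfolding C_def by simp
    also have "\<dots> = (\<integral>\<^sup>+x. ennreal (k (C x)) * indicator A (C x) \<partial>lborel)"
      by (subst nn_integral_distr) simp_all
    also have "\<dots> = (\<integral>\<^sup>+x\<in>V ` A. ennreal (k (C x)) \<partial>lborel)"
    proof (intro nn_integral_cong)
      fix x
      have "x \<in> V ` A \<longleftrightarrow> C x \<in> A" by (metis CV VC image_iff)
      then show "ennreal (k (C x)) * indicator A (C x) = ennreal (k (C x)) * indicator (V ` A) x"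
        by (simp add: indicator_def)
    qed
    finally show ?thesis .
  qed
  have Vim: "V ` A \<in> sets borel" if [measurable]: "A \<in> sets borel" for A
  proof -
    have "V ` A = C -` A \<inter> space borel"
      by (auto simp: image_iff) (metis VC)
    also have "\<dots> \<in> sets borel" by measurable
    finally show ?thesis .
  qed
  let ?G = "\<lambda>x. V (g (C x))" and ?G' = "\<lambda>x v. V (g' (C x) * C v)"
  have det: "\<bar>det (matrix (?G' x))\<bar> = (cmod (g' (C x)))\<^sup>2" for x
    unfolding cmod_power2 by (simp add: det_2 matrix_def C_def V_def axis_def power2_eq_square)
  have im: "?G ` V ` S = V ` g ` S"
    by (auto simp: image_iff)
  have "(\<integral>\<^sup>+z\<in>S. ennreal ((cmod (g' z))\<^sup>2 * h (g z)) \<partial>lborel) =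
      (\<integral>\<^sup>+x\<in>V ` S. ennreal (\<bar>det (matrix (?G' x))\<bar> * h (C (?G x))) \<partial>lborel)"
    unfolding det by (subst transfer) simp_all
  also have "\<dots> = (\<integral>\<^sup>+y\<in>?G ` V ` S. ennreal (h (C y)) \<partial>lborel)"
  proof (rule nn_integral_change_of_variables)
    show "inj_on ?G (V ` S)"
      using inj by (auto simp: inj_on_def) (metis CV)
    fix x assume "x \<in> V ` S"
    then have "C x \<in> S" by auto
    have CVS: "C ` V ` S = S" by (auto simp: image_iff)
    have "(g has_derivative (*) (g' (C x))) (at (C x) within C ` V ` S)"
      using der[OF \<open>C x \<in> S\<close>] unfolding has_field_derivative_def CVS .
    from has_derivative_in_compose[OF bounded_linear_imp_has_derivative[OF blC] this]
    show "(?G has_derivative ?G' x) (at x within V ` S)"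
      by (rule bounded_linear.has_derivative[OF blV])
  qed (auto simp: det im h Vim)
  also have "\<dots> = (\<integral>\<^sup>+w\<in>g ` S. ennreal (h w) \<partial>lborel)"
    unfolding im by (rule transfer[symmetric]) simp_all
  finally show ?thesis .
qed

section \<open>Integrability of a point singularity\<close>

text \<open>Where the norm lies between \<open>R / 2^(n+1)\<close> and \<open>R / 2^n\<close>, the integrand is at most
the value at the inner radius. Enlarging each shell to the whole ball of its outer radius still
leaves a geometric series with ratio \<open>2 powr (a - DIM('a))\<close>.\<close>

lemma nn_integral_norm_powr_ball_finite:
  fixes a R :: real
  assumes a: "0 \<le> a" "a < DIM('a)" and R: "0 < R"
  shows "(\<integral>\<^sup>+x\<in>ball (0::'a::euclidean_space) R. ennreal (norm x powr (-a)) \<partial>lborel) < \<infinity>"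
proof -
  let ?d = "DIM('a)"
  define r where "r n = R / 2 ^ n" for n :: nat
  have r: "0 < r n" for n using R by (simp add: r_def)
  let ?s = "\<lambda>n. r (Suc n) powr (-a) * (unit_ball_vol ?d * r n ^ ?d)"
  let ?c = "R powr (-a) * 2 powr a * (unit_ball_vol ?d * R ^ ?d)"
  have s: "?s n = ?c * (2 powr (a - ?d)) ^ n" for n
  proof -
    have "r (Suc n) powr (-a) = R powr (-a) * 2 powr a * 2 powr (a * n)"
      using R by (simp add: r_def powr_divide powr_minus divide_simps powr_mult)
        (simp add: powr_add[symmetric] powr_realpow[symmetric] powr_powr algebra_simps)
    moreover have "r n ^ ?d = R ^ ?d * 2 powr (- real ?d * n)"
      by (simp add: r_def power_divide powr_minus divide_simps)
        (simp add: powr_realpow[symmetric] powr_powr algebra_simps)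
    moreover have "(2 powr (a - ?d)) ^ n = 2 powr (a * n) * 2 powr (- real ?d * n)"
      by (simp add: powr_realpow[symmetric] powr_powr powr_add[symmetric] algebra_simps)
    ultimately show ?thesis by (simp only: mult_ac)
  qed
  have "2 powr (a - ?d) < 2 powr 0"
    using a by (intro powr_less_mono) auto
  then have "summable ?s"
    unfolding s by (intro summable_mult summable_geometric) simp
  moreover have s0: "0 \<le> ?s n" for n
    using r[of n] by simp
  ultimately have fin: "(\<Sum>n. ennreal (?s n)) < \<infinity>"
    by (simp add: suminf_ennreal2)
  have single: "F n \<le> (\<Sum>i. F i)" for F :: "nat \<Rightarrow> ennreal" and n
    using sum_le_suminf[of F "{n}"] by simp
  have "(\<integral>\<^sup>+x\<in>ball (0::'a) R. ennreal (norm x powr (-a)) \<partial>lborel) \<le>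
      (\<integral>\<^sup>+(x::'a). (\<Sum>n. ennreal (r (Suc n) powr (-a)) * indicator (ball 0 (r n)) x) \<partial>lborel)"
  proof (rule nn_integral_mono)
    fix x :: 'a
    show "ennreal (norm x powr (-a)) * indicator (ball 0 R) x \<le>
      (\<Sum>n. ennreal (r (Suc n) powr (-a)) * indicator (ball 0 (r n)) x)"
    proof (cases "x \<noteq> 0 \<and> norm x < R")
      case True
      have "\<exists>n. r (Suc n) \<le> norm x"
      proof -
        obtain n where "R / norm x < 2 ^ n" using real_arch_pow[of 2] by auto
        then have "r (Suc n) \<le> norm x" 
          using True R by (simp add: r_def field_simps)
        then show ?thesis by blast
      qed
      \<comment> \<open>The shell that contains \<open>x\<close>: its term alone already dominates.\<close>
      define n where "n = (LEAST n. r (Suc n) \<le> norm x)"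
      have n: "r (Suc n) \<le> norm x"
        unfolding n_def using \<open>\<exists>n. _\<close> by (rule LeastI_ex)
      have "norm x < r n"
      proof (cases n)
        case 0 then show ?thesis using True by (simp add: r_def)
      next
        case (Suc m)
        then have "\<not> r (Suc m) \<le> norm x" using not_less_Least[of m "\<lambda>n. r (Suc n) \<le> norm x"] unfolding n_def by simp
        then show ?thesis using Suc by simp
      qed
      then have "ennreal (norm x powr (-a)) * indicator (ball 0 R) x \<le>
          ennreal (r (Suc n) powr (-a)) * indicator (ball 0 (r n)) x"
        using True n a r[of "Suc n"] by (auto intro!: ennreal_leI powr_mono2')
      also have "\<dots> \<le> (\<Sum>n. ennreal (r (Suc n) powr (-a)) * indicator (ball 0 (r n)) x)"
        by (rule single)
      finally show ?thesis .
    qed auto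
  qed
  also have "\<dots> = (\<Sum>n. \<integral>\<^sup>+(x::'a). ennreal (r (Suc n) powr (-a)) * indicator (ball 0 (r n)) x \<partial>lborel)"
    by (intro nn_integral_suminf borel_measurable_times_ennreal borel_measurable_const
        borel_measurable_indicator) simp
  also have "\<dots> = (\<Sum>n. ennreal (?s n))"
  proof (rule suminf_cong)
    fix n
    have "(\<integral>\<^sup>+(x::'a). ennreal (r (Suc n) powr (-a)) * indicator (ball 0 (r n)) x \<partial>lborel) =
        ennreal (r (Suc n) powr (-a)) * emeasure lborel (ball (0::'a) (r n))"
      by (rule nn_integral_cmult_indicator) simp
    also have "emeasure lborel (ball (0::'a) (r n)) = ennreal (unit_ball_vol ?d * r n ^ ?d)"
      using r[of n] by (intro emeasure_ball) simp
    also have "ennreal (r (Suc n) powr (-a)) * \<dots> = ennreal (?s n)"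
      using r[of n] by (intro ennreal_mult[symmetric]) auto
    finally show "(\<integral>\<^sup>+(x::'a). ennreal (r (Suc n) powr (-a)) * indicator (ball 0 (r n)) x \<partial>lborel) =
        ennreal (?s n)" .
  qed
  finally show ?thesis using fin by simp
qed

lemma nn_integral_lborel_reflect:
  fixes h :: "'a::euclidean_space \<Rightarrow> ennreal"
  assumes [measurable]: "h \<in> borel_measurable borel"
  shows "(\<integral>\<^sup>+x. h (c - x) \<partial>lborel) = (\<integral>\<^sup>+x. h x \<partial>lborel)"
proof -
  have "lborel = density (distr lborel borel (\<lambda>x::'a. c - x)) (\<lambda>_. 1)"
    using lborel_affine[of "-1" c] by simp
  then have "lborel = distr lborel borel (\<lambda>x::'a. c - x)"
    by (simp add: density_1)
  then have "(\<integral>\<^sup>+x. h x \<partial>lborel) = (\<integral>\<^sup>+x. h x \<partial>distr lborel borel (\<lambda>x. c - x))"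
    by simp
  then show ?thesis by (simp add: nn_integral_distr)
qed

text \<open>With \<open>a = p * (2 - \<epsilon>)\<close> and \<open>b = p * (2 + \<epsilon>)\<close> the integrand is
the \<open>p\<close>-th power of the modulus of
\<open>(1 + z) powr (2 - \<epsilon>) / (1 - z) powr (2 + \<epsilon>)\<close>. Only the point 1 matters, since
\<open>\<bar>1 + z\<bar> \<le> 2\<close>.\<close>

lemma two_sided_weight_integrable:
  fixes a b :: real
  assumes "0 \<le> a" "0 \<le> b" "b < 2"
  shows "(\<integral>\<^sup>+z\<in>ball 0 1. ennreal (cmod (1 + z) powr a * cmod (1 - z) powr (- b)) \<partial>lborel) < \<infinity>"
proof -
  define k :: "complex \<Rightarrow> ennreal"
    where "k u = ennreal (cmod u powr (- b)) * indicator (ball 0 2) u" for u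
  have "(\<lambda>u::complex. cmod u powr (- b)) \<in> borel_measurable borel"
    by measurable
  then have [measurable]: "k \<in> borel_measurable borel"
    unfolding k_def
    by (intro borel_measurable_times_ennreal borel_measurable_indicator
        measurable_compose[OF _ measurable_ennreal]) simp_all
  have "(\<integral>\<^sup>+z\<in>ball 0 1. ennreal (cmod (1 + z) powr a * cmod (1 - z) powr (- b)) \<partial>lborel)
      \<le> (\<integral>\<^sup>+z. ennreal (2 powr a) * k (1 - z) \<partial>lborel)"
  proof (rule nn_integral_mono)
    fix z :: complex
    have "cmod (1 + z) powr a * cmod (1 - z) powr (- b) \<le> 2 powr a * cmod (1 - z) powr (- b)"
      and "cmod (1 - z) < 2" if "cmod z < 1"
      using that assms norm_triangle_ineq[of 1 z] norm_triangle_ineq4[of 1 z]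
      by (auto intro!: mult_right_mono powr_mono2)
    then show "ennreal (cmod (1 + z) powr a * cmod (1 - z) powr (- b)) * indicator (ball 0 1) z
        \<le> ennreal (2 powr a) * k (1 - z)"
      by (auto simp: k_def indicator_def ennreal_mult[symmetric] intro!: ennreal_leI)
  qed
  also have "\<dots> = ennreal (2 powr a) * (\<integral>\<^sup>+u. k u \<partial>lborel)"
    by (simp add: nn_integral_cmult nn_integral_lborel_reflect)
  also have "\<dots> < \<infinity>"
    using nn_integral_norm_powr_ball_finite[of b 2, where 'a = complex] assms
    by (simp add: ennreal_mult_less_top k_def)
  finally show ?thesis .
qed

section \<open>Squaring the unit disc\<close>

text \<open>The principal square root inverts squaring here: away from the slit \<open>(-\<infinity>, 0]\<close> it
takes its values in the open right half plane.\<close>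

lemma square_image_right_half_disc:
  "(\<lambda>z::complex. z\<^sup>2) ` (ball 0 1 \<inter> {z. 0 < Re z}) = ball 0 1 - \<real>\<^sub>\<le>\<^sub>0"
proof (intro equalityI subsetI)
  fix w :: complex assume "w \<in> (\<lambda>z. z\<^sup>2) ` (ball 0 1 \<inter> {z. 0 < Re z})"
  then obtain z where z: "w = z\<^sup>2" "cmod z < 1" "0 < Re z" by auto
  have "cmod w < 1"
    using z by (simp add: norm_power power_less_one_iff)
  moreover have "w \<notin> \<real>\<^sub>\<le>\<^sub>0"
  proof
    assume "w \<in> \<real>\<^sub>\<le>\<^sub>0"
    then have "Re (z\<^sup>2) \<le> 0" "Im (z\<^sup>2) = 0"
      using z by (auto simp: complex_nonpos_Reals_iff)
    then have "Re z * Im z = 0" "(Re z)\<^sup>2 \<le> (Im z)\<^sup>2"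
      unfolding Re_power2 Im_power2 by auto
    then show False using z by auto
  qed
  ultimately show "w \<in> ball 0 1 - \<real>\<^sub>\<le>\<^sub>0" by simp
next
  fix w :: complex assume w: "w \<in> ball 0 1 - \<real>\<^sub>\<le>\<^sub>0"
  have "Re (csqrt w) \<noteq> 0"
  proof
    assume "Re (csqrt w) = 0"
    then have "Re ((csqrt w)\<^sup>2) \<le> 0" "Im ((csqrt w)\<^sup>2) = 0"
      unfolding Re_power2 Im_power2 by auto
    then show False using w by (simp add: complex_nonpos_Reals_iff)
  qed
  then have "0 < Re (csqrt w)"
    using Re_csqrt[of w] by simp
  then show "w \<in> (\<lambda>z. z\<^sup>2) ` (ball 0 1 \<inter> {z. 0 < Re z})"
    using w by (intro image_eqI[of _ _ "csqrt w"]) (auto simp: norm_csqrt)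
qed

lemma AE_lborel_inner_neq_0:
  fixes b :: "'a::euclidean_space"
  assumes "b \<noteq> 0"
  shows "AE x in lborel. b \<bullet> x \<noteq> 0"
proof -
  have "{x. b \<bullet> x = 0} \<in> null_sets lebesgue"
    using negligible_hyperplane[of b 0] assms by (simp add: negligible_iff_null_sets)
  then have "{x. b \<bullet> x = 0} \<in> null_sets lborel"
    by (subst null_sets_completion_iff[symmetric]) simp_all
  then show ?thesis
    by (rule AE_not_in[THEN AE_mp]) simp
qed

text \<open>Squaring covers the unit disc twice, once from each half disc cut out by the imaginary axis. On
the right half disc it is injective with Jacobian \<open>\<bar>2z\<bar>\<^sup>2\<close> and misses only
a null set of the disc; the left half disc contributes the same by the symmetry
\<open>z \<mapsto> -z\<close>.\<close>

lemma nn_integral_unit_disc_square: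
  fixes h :: "complex \<Rightarrow> real"
  assumes [measurable]: "h \<in> borel_measurable borel" and nonneg: "\<And>z. 0 \<le> h z"
  shows "(\<integral>\<^sup>+z\<in>ball 0 1. ennreal (4 * (cmod z)\<^sup>2 * h (z\<^sup>2)) \<partial>lborel) =
    2 * (\<integral>\<^sup>+w\<in>ball 0 1. ennreal (h w) \<partial>lborel)"
proof -
  let ?S = "ball 0 1 \<inter> {z. 0 < Re z}"
  let ?k = "\<lambda>z. ennreal (4 * (cmod z)\<^sup>2 * h (z\<^sup>2))"
  have [measurable]: "?S \<in> sets borel"
    by (intro sets.Int borel_open open_halfspace_Re_gt) auto
  have im [measurable]: "ball 0 1 - \<real>\<^sub>\<le>\<^sub>0 \<in> sets (borel :: complex measure)"
    using closed_nonpos_Reals_complex by (intro sets.Diff borel_open borel_closed) auto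
  have "inj_on (\<lambda>z. z\<^sup>2) ?S"
    by (auto simp: inj_on_def power2_eq_iff)
  then have "(\<integral>\<^sup>+z\<in>?S. ennreal ((cmod (2 * z))\<^sup>2 * h (z\<^sup>2)) \<partial>lborel) =
      (\<integral>\<^sup>+w\<in>(\<lambda>z. z\<^sup>2) ` ?S. ennreal (h w) \<partial>lborel)"
    using im unfolding square_image_right_half_disc[symmetric]
    by (intro nn_integral_holomorphic_substitution)
      (auto intro!: derivative_eq_intros simp: nonneg)
  moreover have "(\<integral>\<^sup>+w\<in>(\<lambda>z. z\<^sup>2) ` ?S. ennreal (h w) \<partial>lborel) = (\<integral>\<^sup>+w\<in>ball 0 1. ennreal (h w) \<partial>lborel)"
    unfolding square_image_right_half_disc using AE_lborel_inner_neq_0[of "\<i>"]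
    by (intro nn_integral_cong_AE) (auto simp: complex_nonpos_Reals_iff indicator_def)
  ultimately have half: "(\<integral>\<^sup>+z\<in>?S. ?k z \<partial>lborel) = (\<integral>\<^sup>+w\<in>ball 0 1. ennreal (h w) \<partial>lborel)"
    by (simp add: norm_mult power_mult_distrib)
  have "(\<integral>\<^sup>+z\<in>ball 0 1. ?k z \<partial>lborel) =
      (\<integral>\<^sup>+z. ?k z * indicator ?S z + ?k (- z) * indicator ?S (- z) \<partial>lborel)"
    using AE_lborel_inner_neq_0[of "1::complex"]
    by (intro nn_integral_cong_AE) (auto simp: indicator_def)
  also have "\<dots> = (\<integral>\<^sup>+z\<in>?S. ?k z \<partial>lborel) + (\<integral>\<^sup>+z. ?k (- z) * indicator ?S (- z) \<partial>lborel)"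
    by (subst nn_integral_add) simp_all
  also have "(\<integral>\<^sup>+z. ?k (- z) * indicator ?S (- z) \<partial>lborel) = (\<integral>\<^sup>+z\<in>?S. ?k z \<partial>lborel)"
    using nn_integral_lborel_reflect[of "\<lambda>z. ?k z * indicator ?S z" 0] by simp
  finally show ?thesis
    unfolding half by (simp add: mult_2)
qed

section \<open>The sum of the two functions\<close>

text \<open>Over the common denominator the numerators become
\<open>(1 + z)^4 - (1 - z)^4 = 8 z (1 + z^2)\<close>, because the real exponents
\<open>2 - \<epsilon>\<close> and \<open>2 + \<epsilon>\<close> add up to an integer. Up to the factor
\<open>8 z\<close> the sum is thus a function of \<open>z^2\<close> with the same singular factor
\<open>(1 - w)\<close> to the power \<open>-(2 + \<epsilon>)\<close>, at \<open>w = z^2\<close>, as the first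
summand at \<open>w\<close>.\<close>

lemma add_reflect_closed_form:
  fixes z :: complex and \<epsilon> :: real
  assumes z: "cmod z < 1"
  shows "cmod ((1 + z) powr of_real (2 - \<epsilon>) / (1 - z) powr of_real (2 + \<epsilon>)
      - (1 - z) powr of_real (2 - \<epsilon>) / (1 + z) powr of_real (2 + \<epsilon>)) =
    8 * cmod z * cmod (1 + z\<^sup>2) * cmod (1 - z\<^sup>2) powr (- (2 + \<epsilon>))"
proof -
  let ?b = "complex_of_real (2 + \<epsilon>)" and ?a = "complex_of_real (2 - \<epsilon>)"
  have nz: "1 + z \<noteq> 0" "1 - z \<noteq> 0"
    using z by (auto simp: add_eq_0_iff)
  have four: "u powr ?a * u powr ?b = u ^ 4" if "u \<noteq> 0" for u :: complex
  proof -
    have "u powr ?a * u powr ?b = u powr (of_nat 4)"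
      by (simp flip: powr_add)
    then show ?thesis using that by (simp only: powr_nat) simp
  qed
  have "(1 + z) powr ?a / (1 - z) powr ?b - (1 - z) powr ?a / (1 + z) powr ?b =
      ((1 + z) powr ?a * (1 + z) powr ?b - (1 - z) powr ?a * (1 - z) powr ?b)
      / ((1 - z) powr ?b * (1 + z) powr ?b)"
    using nz by (simp add: diff_frac_eq mult_ac)
  also have "\<dots> = ((1 + z) ^ 4 - (1 - z) ^ 4) / ((1 - z) powr ?b * (1 + z) powr ?b)"
    unfolding four[OF nz(1)] four[OF nz(2)] ..
  also have "(1 + z) ^ 4 - (1 - z) ^ 4 = 8 * z * (1 + z\<^sup>2)"
    by (simp add: power4_eq_xxxx power2_eq_square algebra_simps)
  finally have "cmod ((1 + z) powr ?a / (1 - z) powr ?b - (1 - z) powr ?a / (1 + z) powr ?b) =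
      8 * cmod z * cmod (1 + z\<^sup>2) / (cmod (1 - z) powr (2 + \<epsilon>) * cmod (1 + z) powr (2 + \<epsilon>))"
    by (simp add: norm_divide norm_mult norm_powr_real_powr')
  also have "cmod (1 - z) powr (2 + \<epsilon>) * cmod (1 + z) powr (2 + \<epsilon>) = cmod (1 - z\<^sup>2) powr (2 + \<epsilon>)"
    by (simp add: powr_mult[symmetric] norm_mult[symmetric] power2_eq_square algebra_simps)
  finally show ?thesis
    unfolding powr_minus divide_inverse .
qed

text \<open>To be read with \<open>r = \<bar>z\<bar>\<close> and \<open>s = \<bar>1 + z^2\<bar>\<close>. Dividing by
\<open>s powr p\<close> leaves \<open>s powr (p * (1 - \<epsilon>))\<close> on the left. The bound
\<open>\<epsilon> \<le> 1\<close> makes this exponent nonnegative, so \<open>s\<close> may be replaced by 2,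
and \<open>(1 - p) / p \<le> \<epsilon>\<close> says precisely that the exponent is at most
\<open>2 * p - 1\<close>. Then the powers of 2 on the two sides agree exactly, and
\<open>r\<^sup>2 < r powr p\<close> gives the strict inequality.\<close>

lemma pointwise_weight_bound:
  fixes p \<epsilon> r s :: real
  assumes p: "0 < p" "p < 1" and eps: "\<epsilon> \<le> 1" "(1 - p) / p \<le> \<epsilon>"
    and r: "0 < r" "r < 1" and s: "0 < s" "s \<le> 2"
  shows "2 powr p * (4 * r\<^sup>2 * s powr (p * (2 - \<epsilon>))) < 2 * (8 * r * s) powr p"
proof -
  have "1 - p \<le> p * \<epsilon>"
    using eps p by (simp add: field_simps)
  then have e: "p * (1 - \<epsilon>) \<le> 2 * p - 1"
    by (simp add: algebra_simps)
  have "s powr (p * (1 - \<epsilon>)) \<le> 2 powr (p * (1 - \<epsilon>))"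
    using s p eps by (intro powr_mono2) auto
  also have "\<dots> \<le> 2 powr (2 * p - 1)"
    using e by simp
  finally have sb: "s powr (p * (2 - \<epsilon>)) \<le> 2 powr (2 * p - 1) * s powr p"
    using mult_right_mono[of "s powr (p * (1 - \<epsilon>))" "2 powr (2 * p - 1)" "s powr p"]
    by (simp add: powr_add[symmetric] algebra_simps)
  have "r powr 2 < r powr p"
    using r p by (intro powr_less_mono') auto
  then have "r\<^sup>2 < r powr p" using r by simp
  have "2 powr p * (4 * r\<^sup>2 * s powr (p * (2 - \<epsilon>))) \<le>
      2 powr p * (4 * r\<^sup>2 * (2 powr (2 * p - 1) * s powr p))"
    using sb by (intro mult_left_mono) auto
  also have "\<dots> < 2 powr p * (4 * r powr p * (2 powr (2 * p - 1) * s powr p))"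
    using \<open>r\<^sup>2 < r powr p\<close> s by simp
  also have "\<dots> = 2 * ((2 powr 3) powr p * r powr p * s powr p)"
    unfolding powr_powr by (simp add: powr_diff powr_add[symmetric] algebra_simps)
  also have "\<dots> = 2 * (8 * r * s) powr p"
    using r s by (simp add: powr_mult)
  finally show ?thesis .
qed

section \<open>Comparison of the Bergman norms\<close>

lemma nn_integral_disk_area:
  assumes [measurable]: "h \<in> borel_measurable borel"
    and eq: "\<And>z. cmod z < 1 \<Longrightarrow> k z = h z"
  shows "(\<integral>\<^sup>+z. k z \<partial>disk_area) = ennreal (1 / pi) * (\<integral>\<^sup>+z\<in>ball 0 1. h z \<partial>lborel)"
proof -
  have "(\<integral>\<^sup>+z. k z \<partial>disk_area) = (\<integral>\<^sup>+z. h z \<partial>disk_area)"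
    by (intro nn_integral_cong) (simp add: disk_area_def space_scale_measure space_restrict_space eq)
  also have "\<dots> = ennreal (1 / pi) * (\<integral>\<^sup>+z\<in>ball 0 1. h z \<partial>lborel)"
    unfolding disk_area_def
    by (subst nn_integral_scale_measure) (simp_all add: nn_integral_restrict_space measurable_restrict_space1)
  finally show ?thesis .
qed

lemma bergman_norm_finite:
  assumes "(\<integral>\<^sup>+z. ennreal (cmod (f z) powr p) \<partial>disk_area) = ennreal A" "0 \<le> A"
  shows "bergman_norm p f = ennreal (A powr (1 / p))"
  using assms by (simp add: bergman_norm_def)

text \<open>The integral on the right may be infinite; then the conclusion holds because the functional takes
the value \<open>\<infinity>\<close>.\<close>

lemma bergman_norm_gt:
  assumes "ennreal A < (\<integral>\<^sup>+z. ennreal (cmod (f z) powr p) \<partial>disk_area)" "0 \<le> A" "0 < p"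
  shows "ennreal (A powr (1 / p)) < bergman_norm p f"
proof (cases "(\<integral>\<^sup>+z. ennreal (cmod (f z) powr p) \<partial>disk_area)")
  case (real B)
  then have "A powr (1 / p) < B powr (1 / p)"
    using assms by (intro powr_less_mono2) (auto simp: ennreal_less_iff)
  then show ?thesis
    using real assms by (auto simp: bergman_norm_finite ennreal_less_iff)
next
  case top
  then show ?thesis by (simp add: bergman_norm_def)
qed

lemma set_nn_integral_strict_mono:
  assumes [measurable]: "u \<in> borel_measurable M" "v \<in> borel_measurable M" "B \<in> sets M"
    and fin: "(\<integral>\<^sup>+x\<in>B. u x \<partial>M) \<noteq> \<infinity>"
    and less: "AE x in M. x \<in> B \<longrightarrow> u x < v x"
    and pos: "emeasure M B \<noteq> 0"
  shows "(\<integral>\<^sup>+x\<in>B. u x \<partial>M) < (\<integral>\<^sup>+x\<in>B. v x \<partial>M)"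
proof (rule nn_integral_less[OF _ _ fin])
  show "AE x in M. u x * indicator B x \<le> v x * indicator B x"
    using less by eventually_elim (auto simp: indicator_def)
  show "\<not> (AE x in M. v x * indicator B x \<le> u x * indicator B x)"
  proof
    assume "AE x in M. v x * indicator B x \<le> u x * indicator B x"
    with less have "AE x in M. x \<notin> B"
      by eventually_elim (auto simp: indicator_def split: if_splits)
    then have "B \<in> null_sets M"
      by (subst AE_iff_null_sets) auto
    with pos show False by auto
  qed
qed measurable

theorem theorem5:
  fixes p \<epsilon> :: real and f g :: "complex \<Rightarrow> complex"
  assumes "1 / 2 \<le> p" and "p < 1"
    and "\<epsilon> \<le> 1" and "(1 - p) / p \<le> \<epsilon>" and "\<epsilon> < 2 * (1 - p) / p"
    and f: "\<And>z. z \<in> ball 0 1 \<Longrightarrow>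
      f z = (1 + z) powr complex_of_real (2 - \<epsilon>) / (1 - z) powr complex_of_real (2 + \<epsilon>)"
    and g: "\<And>z. z \<in> ball 0 1 \<Longrightarrow> g z = - f (- z)"
  shows "(\<forall>z\<in>ball 0 1. g z =
            - ((1 - z) powr complex_of_real (2 - \<epsilon>) / (1 + z) powr complex_of_real (2 + \<epsilon>)))
         \<and> bergman_norm p (\<lambda>z. f z + g z) > bergman_norm p f + bergman_norm p g"
proof
  show g_eq: "\<forall>z\<in>ball 0 1. g z =
      - ((1 - z) powr complex_of_real (2 - \<epsilon>) / (1 + z) powr complex_of_real (2 + \<epsilon>))"
    using f g by simp
  have p: "0 < p" using assms by simp
  have "0 \<le> (1 - p) / p" using assms p by simp
  then have eps0: "0 \<le> \<epsilon>" using assms by linarith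
  \<comment> \<open>The upper bound on \<open>\<epsilon>\<close> makes the singularity of \<open>f\<close> at 1 integrable.\<close>
  have crit: "p * (2 + \<epsilon>) < 2"
    using \<open>\<epsilon> < _\<close> p by (simp add: field_simps)
  \<comment> \<open>\<open>h\<close> and \<open>k\<close> are the \<open>p\<close>-th powers of the moduli of \<open>f\<close> and \<open>f + g\<close>, as
    functions on the whole plane so that they are Borel measurable.\<close>
  define h where "h z = cmod (1 + z) powr (p * (2 - \<epsilon>)) * cmod (1 - z) powr (- (p * (2 + \<epsilon>)))" for z
  define k where "k z = (8 * cmod z * cmod (1 + z\<^sup>2) * cmod (1 - z\<^sup>2) powr (- (2 + \<epsilon>))) powr p" for z
  have [measurable]: "h \<in> borel_measurable borel" "k \<in> borel_measurable borel"
    unfolding h_def k_def by measurable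
  have h0: "0 \<le> h z" for z by (simp add: h_def)

  have f_h: "cmod (f z) powr p = h z" if "cmod z < 1" for z
  proof -
    have "cmod (f z) = cmod (1 + z) powr (2 - \<epsilon>) / cmod (1 - z) powr (2 + \<epsilon>)"
      using that by (simp add: f norm_divide norm_powr_real_powr')
    then show ?thesis
      by (simp add: h_def powr_divide powr_powr powr_minus_divide mult.commute)
  qed
  have g_h: "cmod (g z) powr p = h (- z)" if "cmod z < 1" for z
    using that f_h[of "- z"] by (simp add: g)
  have fg_k: "cmod (f z + g z) powr p = k z" if "cmod z < 1" for z
    using that add_reflect_closed_form[OF that, of \<epsilon>] g_eq by (simp add: f k_def)

  have below: "2 powr p * (4 * (cmod z)\<^sup>2 * h (z\<^sup>2)) < 2 * k z" if z: "cmod z < 1" "z \<noteq> 0" for z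
  proof -
    let ?c = "cmod (1 - z\<^sup>2) powr (- (p * (2 + \<epsilon>)))"
    have z2: "cmod (z\<^sup>2) < 1"
      using z by (simp add: norm_power power_less_one_iff)
    have nz: "1 - z\<^sup>2 \<noteq> 0" "1 + z\<^sup>2 \<noteq> 0"
      using z2 by (auto simp: add_eq_0_iff)
    have "cmod (1 + z\<^sup>2) \<le> 2"
      using z2 norm_triangle_ineq[of 1 "z\<^sup>2"] by simp
    then have "2 powr p * (4 * (cmod z)\<^sup>2 * cmod (1 + z\<^sup>2) powr (p * (2 - \<epsilon>))) * ?c
        < 2 * (8 * cmod z * cmod (1 + z\<^sup>2)) powr p * ?c"
      using assms z nz p by (intro mult_strict_right_mono pointwise_weight_bound) auto
    moreover have "k z = (8 * cmod z * cmod (1 + z\<^sup>2)) powr p * ?c"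
    proof -
      have "?c = (cmod (1 - z\<^sup>2) powr (- (2 + \<epsilon>))) powr p"
        by (simp add: powr_powr algebra_simps)
      then show ?thesis
        unfolding k_def by (simp only: powr_mult)
    qed
    ultimately show ?thesis
      by (simp add: h_def mult_ac)
  qed

  let ?H = "\<integral>\<^sup>+z\<in>ball 0 1. ennreal (h z) \<partial>lborel"
  \<comment> \<open>Without finiteness the pointwise strict inequality would not survive integration.\<close>
  have H: "?H < \<infinity>"
    unfolding h_def using assms eps0 p crit by (intro two_sided_weight_integrable) auto
  have scale: "(\<integral>\<^sup>+z\<in>ball 0 1. ennreal (c * u z) \<partial>lborel) =
      ennreal c * (\<integral>\<^sup>+z\<in>ball 0 1. ennreal (u z) \<partial>lborel)"
    if "0 \<le> c" and [measurable]: "u \<in> borel_measurable borel" for c and u :: "complex \<Rightarrow> real"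
  proof -
    have [measurable]: "(\<lambda>z. ennreal (u z) * indicator (ball 0 1) z) \<in> borel_measurable lborel"
      by (intro borel_measurable_times_ennreal borel_measurable_indicator) simp_all
    show ?thesis
      using that by (simp add: ennreal_mult' mult.assoc nn_integral_cmult)
  qed
  \<comment> \<open>The integral of \<open>h\<close>, rewritten over the same variable \<open>z\<close> as the integral of \<open>k\<close>. Both
    sides of the comparison now carry the factor 2 of the double covering.\<close>
  have square: "(\<integral>\<^sup>+z\<in>ball 0 1. ennreal (2 powr p * (4 * (cmod z)\<^sup>2 * h (z\<^sup>2))) \<partial>lborel)
      = ennreal (2 powr p) * (2 * ?H)"
    using nn_integral_unit_disc_square[of h] h0 by (subst scale) simp_all
  have "ennreal (2 powr p) * (2 * ?H) < (\<integral>\<^sup>+z\<in>ball 0 1. ennreal (2 * k z) \<partial>lborel)"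
    unfolding square[symmetric]
  proof (rule set_nn_integral_strict_mono)
    show "(\<integral>\<^sup>+z\<in>ball 0 1. ennreal (2 powr p * (4 * (cmod z)\<^sup>2 * h (z\<^sup>2))) \<partial>lborel) \<noteq> \<infinity>"
      unfolding square using H by (simp add: ennreal_mult_eq_top_iff)
    show "AE z in lborel. z \<in> ball 0 1 \<longrightarrow>
        ennreal (2 powr p * (4 * (cmod z)\<^sup>2 * h (z\<^sup>2))) < ennreal (2 * k z)"
      using AE_lborel_inner_neq_0[of "1::complex", OF one_neq_zero]
    proof eventually_elim
      case (elim z)
      then have "z \<noteq> 0" by auto
      then show ?case
        using below[of z] h0[of "z\<^sup>2"] by (auto simp: ennreal_less_iff)
    qed
    show "emeasure lborel (ball (0::complex) 1) \<noteq> 0"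
      by (simp add: emeasure_ball unit_ball_vol_2)
  qed simp_all
  also have "\<dots> = 2 * (\<integral>\<^sup>+z\<in>ball 0 1. ennreal (k z) \<partial>lborel)"
    by (subst scale) (simp_all add: k_def)
  finally have "2 * (ennreal (2 powr p) * ?H) < 2 * (\<integral>\<^sup>+z\<in>ball 0 1. ennreal (k z) \<partial>lborel)"
    by (simp only: mult.left_commute)
  then have lt: "ennreal (2 powr p) * ?H < (\<integral>\<^sup>+z\<in>ball 0 1. ennreal (k z) \<partial>lborel)"
    by (meson leD leI mult_left_mono zero_le)

  obtain A where A: "0 \<le> A" "ennreal (1 / pi) * ?H = ennreal A"
    using H by (cases "ennreal (1 / pi) * ?H") (auto simp: ennreal_mult_eq_top_iff)
  have norm_f: "bergman_norm p f = ennreal (A powr (1 / p))"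
    using A by (intro bergman_norm_finite) (simp_all add: nn_integral_disk_area[of "\<lambda>z. ennreal (h z)"] f_h)
  have "(\<integral>\<^sup>+z\<in>ball 0 1. ennreal (h (- z)) \<partial>lborel) = ?H"
    using nn_integral_lborel_reflect[of "\<lambda>z. ennreal (h z) * indicator (ball 0 1) z" 0]
    by (simp add: indicator_def)
  then have norm_g: "bergman_norm p g = ennreal (A powr (1 / p))"
    using A by (intro bergman_norm_finite) (simp_all add: nn_integral_disk_area[of "\<lambda>z. ennreal (h (- z))"] g_h)
  have "ennreal (2 powr p * A) = ennreal (1 / pi) * (ennreal (2 powr p) * ?H)"
    by (simp add: ennreal_mult A(1) mult_ac flip: A(2))
  also have "\<dots> < ennreal (1 / pi) * (\<integral>\<^sup>+z\<in>ball 0 1. ennreal (k z) \<partial>lborel)"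
    using lt by (intro ennreal_mult_strict_left_mono) auto
  also have "\<dots> = (\<integral>\<^sup>+z. ennreal (cmod (f z + g z) powr p) \<partial>disk_area)"
    by (rule nn_integral_disk_area[symmetric]) (simp_all add: fg_k)
  finally have "ennreal ((2 powr p * A) powr (1 / p)) < bergman_norm p (\<lambda>z. f z + g z)"
    using A p by (intro bergman_norm_gt) auto
  moreover have "(2 powr p * A) powr (1 / p) = 2 * A powr (1 / p)"
    using A p by (simp add: powr_mult powr_powr)
  ultimately show "bergman_norm p f + bergman_norm p g < bergman_norm p (\<lambda>z. f z + g z)"
    unfolding norm_f norm_g by (simp flip: ennreal_plus)
qed

end
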